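(* Let $\mathbf p\in\bigwedge M_n$. Then for all integers $i\geq 1$, $h\geq 0$ and $m\ge 0$, $$\overline D_h^{\,m}(\epsilon^i\wedge\mathbf p)=\sum_{j=0}^{m}\binom{m}{j}\,\epsilon^{i+j}\wedge \overline D_{h-1}^{\,j}\,\overline D_h^{\,m-j}\,\mathbf p .$$
   Context: $n$ is a fixed positive integer. $M_n:=X\mathbb Z[X]/(X^{n+1})$ and $\epsilon^i:=X^i+(X^{n+1})$ for $i\ge 1$, so $M_n$ is a free $\mathbb Z$-module with basis $\epsilon^1,\dots,\epsilon^n$ and $\epsilon^m=0$ for $m>n$. $\bigwedge M_n$ is the exterior algebra of $M_n$ over $\mathbb Z$. $D=(D_0,D_1,D_2,\dots)$ is the unique sequence of $\mathbb Z$-module endomorphisms of $\bigwedge M_n$ such that, for all $\mathbf p,\mathbf q\in\bigwedge M_n$, all $h,l\ge 0$ and all $i\ge 1$, $$D_h(\mathbf p\wedge\mathbf q)=\sum_{h_1+h_2=h,\ h_1,h_2\ge 0}D_{h_1}\mathbf p\wedge D_{h_2}\mathbf q,\qquad D_l\,\epsilon^i=\epsilon^{i+l}.$$ In particular $D_0$ is the identity; the $D_h$ commute pairwise. Put $D_t:=\sum_{i\ge 0}D_it^i$, regarded as an element of $\mathrm{End}_{\mathbb Z}(\bigwedge M_n)[[t]]$; it is invertible, and the endomorphisms $\overline D_i$ ($i\ge0$) are defined by writing its formal inverse as $D_t^{-1}=\sum_{i\ge 0}(-1)^i\,\overline D_i\,t^i$. Powers denote iterated composition, with zeroth power the identity.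 Convention: $\overline D_{-1}:=0$. *)

theory Defs
  imports
    "HOL-Computational_Algebra.Polynomial"
    "HOL-Computational_Algebra.Formal_Power_Series"
    "HOL-Library.Cardinality"
begin

text \<open>\<open>M_n = X \<int>[X] / (X^(n+1))\<close>, where \<open>n \<ge> 1\<close> is \<open>CARD('n)\<close> for a finite index type \<open>'n\<close>:
  \<open>trunc_rel n\<close> is congruence modulo \<open>X^(n+1)\<close> on the set \<open>X \<int>[X]\<close> of multiples of \<open>X\<close>.\<close>

definition trunc_rel :: "nat \<Rightarrow> (int poly \<times> int poly) set" where
  "trunc_rel n = {(p, q). monom 1 1 dvd p \<and> monom 1 1 dvd q \<and> monom 1 (n + 1) dvd p - q}"

lemma equiv_trunc_rel: "equiv {p. monom 1 1 dvd p} (trunc_rel n)"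
proof (rule equivI)
  show "trunc_rel n \<subseteq> {p. monom 1 1 dvd p} \<times> {p. monom 1 1 dvd p}"
    by (auto simp: trunc_rel_def)
  show "refl_on {p. monom 1 1 dvd p} (trunc_rel n)" by (auto simp: refl_on_def trunc_rel_def)
  show "sym (trunc_rel n)"
  proof (rule symI)
    fix x y assume "(x, y) \<in> trunc_rel n"
    then show "(y, x) \<in> trunc_rel n"
      using dvd_minus_iff[of "monom 1 (n+1)" "x - y"] by (simp add: trunc_rel_def)
  qed
  show "trans (trunc_rel n)"
  proof (rule transI)
    fix x y z assume "(x, y) \<in> trunc_rel n" "(y, z) \<in> trunc_rel n"
    then show "(x, z) \<in> trunc_rel n"
      unfolding trunc_rel_def using dvd_add[of "monom 1 (n+1)" "x - y" "y - z"] by auto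
  qed
qed

typedef (overloaded) 'n trunc = "{p :: int poly. monom 1 1 dvd p} // trunc_rel CARD('n::finite)"
  by (rule exI[of _ "trunc_rel CARD('n) `` {0}"]) (auto intro: quotientI)

definition residue :: "int poly \<Rightarrow> 'n::finite trunc" where
  "residue p = Abs_trunc (trunc_rel CARD('n) `` {p})"

definition representative :: "'n::finite trunc \<Rightarrow> int poly" where
  "representative x = (SOME p. p \<in> Rep_trunc x)"

lemma residue_eq_iff:
  assumes "monom 1 1 dvd p" "monom 1 1 dvd q"
  shows "(residue p :: 'n::finite trunc) = residue q \<longleftrightarrow> monom 1 (CARD('n) + 1) dvd p - q"
proof -
  have "(residue p :: 'n trunc) = residue q
      \<longleftrightarrow> trunc_rel CARD('n) `` {p} = trunc_rel CARD('n) `` {q}"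
    unfolding residue_def using assms by (intro Abs_trunc_inject) (auto intro: quotientI)
  also have "\<dots> \<longleftrightarrow> (p, q) \<in> trunc_rel CARD('n)"
    using assms by (intro eq_equiv_class_iff[OF equiv_trunc_rel]) auto
  finally show ?thesis using assms by (simp add: trunc_rel_def)
qed

lemma representative:
  "monom 1 1 dvd representative x" "residue (representative x) = (x :: 'n::finite trunc)"
proof -
  let ?R = "trunc_rel CARD('n)"
  obtain p where p: "monom 1 1 dvd p" "Rep_trunc x = ?R `` {p}"
    using Rep_trunc[of x] unfolding quotient_def by blast
  then have "p \<in> Rep_trunc x"
    using equiv_class_self[OF equiv_trunc_rel] by blast
  then have "representative x \<in> Rep_trunc x"
    unfolding representative_def by (rule someI)
  then have rel: "(p, representative x) \<in> ?R" using p by blast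
  then show "monom 1 1 dvd representative x" unfolding trunc_rel_def by blast
  from rel have "?R `` {p} = ?R `` {representative x}"
    by (rule equiv_class_eq[OF equiv_trunc_rel])
  then show "residue (representative x) = x"
    unfolding residue_def p(2)[symmetric] by (metis Rep_trunc_inverse p(2))
qed

instantiation trunc :: (finite) ab_group_add
begin

definition zero_trunc :: "'a trunc" where
  "0 = residue 0"

definition plus_trunc :: "'a trunc \<Rightarrow> 'a trunc \<Rightarrow> 'a trunc" where
  "x + y = residue (representative x + representative y)"

definition uminus_trunc :: "'a trunc \<Rightarrow> 'a trunc" where
  "- x = residue (- representative x)"

definition minus_trunc :: "'a trunc \<Rightarrow> 'a trunc \<Rightarrow> 'a trunc" where
  "x - y = residue (representative x - representative y)"

lemma residue_add:
  assumes "monom 1 1 dvd p" "monom 1 1 dvd q"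
  shows "(residue p :: 'a trunc) + residue q = residue (p + q)"
proof -
  let ?p = "representative (residue p :: 'a trunc)" and ?q = "representative (residue q :: 'a trunc)"
  have "monom 1 (CARD('a) + 1) dvd (?p - p) + (?q - q)"
    using assms by (intro dvd_add) (simp_all add: residue_eq_iff[symmetric] representative
      del: One_nat_def)
  then show ?thesis
    unfolding plus_trunc_def using assms representative(1)
    by (subst residue_eq_iff) (auto simp: algebra_simps simp del: One_nat_def intro!: dvd_add)
qed

lemma residue_minus:
  assumes "monom 1 1 dvd p"
  shows "- (residue p :: 'a trunc) = residue (- p)"
proof -
  let ?p = "representative (residue p :: 'a trunc)"
  have "monom 1 (CARD('a) + 1) dvd - (?p - p)"
    using assms by (subst dvd_minus_iff) (simp_all add: residue_eq_iff[symmetric] representative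
      del: One_nat_def)
  then show ?thesis
    unfolding uminus_trunc_def using assms representative(1)
    by (subst residue_eq_iff) (auto simp: algebra_simps simp del: One_nat_def)
qed

instance
proof
  fix a b c :: "'a trunc"
  have *: "\<exists>p. monom 1 1 dvd p \<and> x = residue p" for x :: "'a trunc"
    using representative[of x] by metis
  obtain p q r where p: "monom 1 1 dvd p" "a = residue p" and q: "monom 1 1 dvd q" "b = residue q"
    and r: "monom 1 1 dvd r" "c = residue r"
    using *[of a] *[of b] *[of c] by blast
  show "a + b + c = a + (b + c)"
    using p q r by (simp add: residue_add dvd_add add.assoc del: One_nat_def)
  show "a + b = b + a"
    using p q by (simp add: residue_add add.commute del: One_nat_def)
  show "0 + a = a"
    using p by (simp add: zero_trunc_def residue_add del: One_nat_def)
  show "- a + a = 0"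
    using p by (simp add: zero_trunc_def residue_add residue_minus del: One_nat_def)
  have "a - b = residue (representative a + - representative b)"
    by (simp add: minus_trunc_def)
  also have "\<dots> = residue (representative a) + residue (- representative b)"
    using representative(1)[of a] representative(1)[of b]
    by (subst residue_add) (simp_all del: One_nat_def)
  also have "\<dots> = a + - b" by (simp add: representative uminus_trunc_def)
  finally show "a - b = a + - b" .
qed

end

text \<open>Only the indices \<open>i \<ge> 1\<close> are meaningful, as \<open>X^0\<close> does not lie in \<open>X \<int>[X]\<close>.\<close>

definition eps :: "nat \<Rightarrow> 'n::finite trunc" where
  "eps i = residue (monom 1 i)"

lemma eps_eq_0:
  assumes "i > CARD('n)"
  shows "eps i = (0 :: 'n::finite trunc)"
proof -
  have "monom (1 :: int) k dvd monom 1 i" if "k \<le> i" for k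
    using that by (intro dvdI[of _ _ "monom 1 (i - k)"]) (simp add: mult_monom)
  from this[of 1] this[of "CARD('n) + 1"] show ?thesis
    using assms unfolding eps_def zero_trunc_def by (subst residue_eq_iff) simp_all
qed

text \<open>The exterior algebra of a \<open>\<int>\<close>-module \<open>M\<close> is the associative unital ring with generators
  \<open>\<iota> x\<close> for \<open>x \<in> M\<close> and relations \<open>\<iota> (x + y) = \<iota> x + \<iota> y\<close> and \<open>\<iota> x \<cdot> \<iota> x = 0\<close>, that is, the tensor
  algebra modulo the squares of the elements of \<open>M\<close>. (Over \<open>\<int>\<close>, additive maps are linear and rings
  are algebras.) It is constructed as the set of ring expressions in the generators modulo the
  congruence generated by the ring axioms and these relations.\<close>

datatype 'm ext_term =
    Gen 'm
  | Zero
  | One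
  | Neg "'m ext_term"
  | Add "'m ext_term" "'m ext_term"
  | Mul "'m ext_term" "'m ext_term"

inductive ext_rel :: "'m::ab_group_add ext_term \<Rightarrow> 'm ext_term \<Rightarrow> bool" where
  refl: "ext_rel a a"
| sym: "ext_rel a b \<Longrightarrow> ext_rel b a"
| trans: "ext_rel a b \<Longrightarrow> ext_rel b c \<Longrightarrow> ext_rel a c"
| Neg_cong: "ext_rel a a' \<Longrightarrow> ext_rel (Neg a) (Neg a')"
| Add_cong: "ext_rel a a' \<Longrightarrow> ext_rel b b' \<Longrightarrow> ext_rel (Add a b) (Add a' b')"
| Mul_cong: "ext_rel a a' \<Longrightarrow> ext_rel b b' \<Longrightarrow> ext_rel (Mul a b) (Mul a' b')"
| Add_assoc: "ext_rel (Add (Add a b) c) (Add a (Add b c))"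
| Add_commute: "ext_rel (Add a b) (Add b a)"
| Add_Zero: "ext_rel (Add Zero a) a"
| Add_Neg: "ext_rel (Add (Neg a) a) Zero"
| Mul_assoc: "ext_rel (Mul (Mul a b) c) (Mul a (Mul b c))"
| Mul_One_left: "ext_rel (Mul One a) a"
| Mul_One_right: "ext_rel (Mul a One) a"
| Add_Mul: "ext_rel (Mul (Add a b) c) (Add (Mul a c) (Mul b c))"
| Mul_Add: "ext_rel (Mul a (Add b c)) (Add (Mul a b) (Mul a c))"
| Gen_add: "ext_rel (Gen (x + y)) (Add (Gen x) (Gen y))"
| Gen_square: "ext_rel (Mul (Gen x) (Gen x)) Zero"

quotient_type (overloaded) 'm exterior = "'m::ab_group_add ext_term" / ext_rel
  by (intro equivpI reflpI sympI transpI) (fact ext_rel.refl ext_rel.sym ext_rel.trans)+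

primrec ext_eval :: "('m \<Rightarrow> 'b::ring_1) \<Rightarrow> 'm ext_term \<Rightarrow> 'b" where
  "ext_eval f (Gen x) = f x"
| "ext_eval f Zero = 0"
| "ext_eval f One = 1"
| "ext_eval f (Neg a) = - ext_eval f a"
| "ext_eval f (Add a b) = ext_eval f a + ext_eval f b"
| "ext_eval f (Mul a b) = ext_eval f a * ext_eval f b"

lemma ext_eval_cong:
  assumes "ext_rel a b" and "\<And>x y. f (x + y) = f x + f y" and "\<And>x. f x * f x = 0"
  shows "ext_eval f a = ext_eval f b"
  using assms(1) by induction (auto simp: assms algebra_simps)

instantiation exterior :: (ab_group_add) ring_1
begin

lift_definition zero_exterior :: "'a exterior" is Zero .
lift_definition one_exterior :: "'a exterior" is One .
lift_definition uminus_exterior :: "'a exterior \<Rightarrow> 'a exterior" is Neg by (rule Neg_cong)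
lift_definition plus_exterior :: "'a exterior \<Rightarrow> 'a exterior \<Rightarrow> 'a exterior" is Add by (rule Add_cong)
lift_definition times_exterior :: "'a exterior \<Rightarrow> 'a exterior \<Rightarrow> 'a exterior" is Mul by (rule Mul_cong)
lift_definition minus_exterior :: "'a exterior \<Rightarrow> 'a exterior \<Rightarrow> 'a exterior"
  is "\<lambda>a b. Add a (Neg b)" by (intro Add_cong Neg_cong)

instance
proof
  show "(0 :: 'a exterior) \<noteq> 1"
  proof (transfer, rule notI)
    assume "ext_rel (Zero :: 'a ext_term) One"
    then have "ext_eval (\<lambda>_. 0 :: int) (Zero :: 'a ext_term) = ext_eval (\<lambda>_. 0) (One :: 'a ext_term)"
      by (rule ext_eval_cong) auto
    then show False by simp
  qed
qed (transfer, rule ext_rel.refl Add_assoc Add_commute Add_Zero Add_Neg Mul_assoc Mul_One_left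
    Mul_One_right Add_Mul Mul_Add)+

end

lift_definition \<iota> :: "'m::ab_group_add \<Rightarrow> 'm exterior" is Gen .

text \<open>The product of the ring \<open>'m exterior\<close> is the exterior product.\<close>

abbreviation wedge :: "'m::ab_group_add exterior \<Rightarrow> 'm exterior \<Rightarrow> 'm exterior" (infixr "\<^bold>\<and>" 70)
  where "p \<^bold>\<and> q \<equiv> p * q"

lemma iota_add: "\<iota> (x + y) = \<iota> x + \<iota> y"
  by transfer (rule Gen_add)

lemma iota_square: "\<iota> x \<^bold>\<and> \<iota> x = 0"
  by transfer (rule Gen_square)

lemma exterior_induct:
  assumes "\<And>x. P (\<iota> x)" "P 0" "P 1" "\<And>p. P p \<Longrightarrow> P (- p)"
    "\<And>p q. P p \<Longrightarrow> P q \<Longrightarrow> P (p + q)" "\<And>p q. P p \<Longrightarrow> P q \<Longrightarrow> P (p \<^bold>\<and> q)"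
  shows "P p"
proof -
  have "P (abs_exterior a)" for a
    by (induction a)
      (simp_all add: assms flip: \<iota>.abs_eq zero_exterior.abs_eq one_exterior.abs_eq
        uminus_exterior.abs_eq plus_exterior.abs_eq times_exterior.abs_eq)
  then show ?thesis by (rule exterior.abs_induct)
qed

text \<open>The universal property (existence part; uniqueness is immediate from
  \<open>exterior_induct\<close>).\<close>

lemma exterior_universal:
  fixes f :: "'m::ab_group_add \<Rightarrow> 'b::ring_1"
  assumes "\<And>x y. f (x + y) = f x + f y" and "\<And>x. f x * f x = 0"
  obtains \<phi> where "\<And>x. \<phi> (\<iota> x) = f x" "\<phi> 1 = 1"
    "\<And>p q. \<phi> (p + q) = \<phi> p + \<phi> q" "\<And>p q. \<phi> (p \<^bold>\<and> q) = \<phi> p * \<phi> q"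
proof
  define \<phi> where "\<phi> = (\<lambda>p. ext_eval f (rep_exterior p))"
  have \<phi>: "\<phi> (abs_exterior a) = ext_eval f a" for a
    unfolding \<phi>_def
    by (rule ext_eval_cong) (auto simp: assms intro: Quotient3_rep_abs[OF Quotient3_exterior] ext_rel.refl)
  show "\<phi> (\<iota> x) = f x" for x by (simp add: \<iota>.abs_eq \<phi>)
  show "\<phi> 1 = 1" by (simp add: one_exterior.abs_eq \<phi>)
  show "\<phi> (p + q) = \<phi> p + \<phi> q" for p q
    by (induction p rule: exterior.abs_induct, induction q rule: exterior.abs_induct)
      (simp add: plus_exterior.abs_eq \<phi>)
  show "\<phi> (p \<^bold>\<and> q) = \<phi> p * \<phi> q" for p q
    by (induction p rule: exterior.abs_induct, induction q rule: exterior.abs_induct)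
      (simp add: times_exterior.abs_eq \<phi>)
qed

abbreviation \<epsilon> :: "nat \<Rightarrow> 'n::finite trunc exterior"
  where "\<epsilon> i \<equiv> \<iota> (eps i)"

typedef (overloaded) 'a endo = "{f :: 'a::ab_group_add \<Rightarrow> 'a. \<forall>x y. f (x + y) = f x + f y}"
  morphisms app Endo
  by (rule exI[of _ id]) simp

setup_lifting type_definition_endo

text \<open>Multiplication is composition. The sort \<open>ring_1\<close> is only needed for \<open>0 \<noteq> 1\<close>.\<close>

instantiation endo :: (ring_1) ring_1
begin

lift_definition zero_endo :: "'a endo" is "\<lambda>_. 0" by simp
lift_definition one_endo :: "'a endo" is "\<lambda>x. x" by simp
lift_definition uminus_endo :: "'a endo \<Rightarrow> 'a endo" is "\<lambda>f x. - f x" by simp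
lift_definition plus_endo :: "'a endo \<Rightarrow> 'a endo \<Rightarrow> 'a endo" is "\<lambda>f g x. f x + g x"
  by (simp add: algebra_simps)
lift_definition minus_endo :: "'a endo \<Rightarrow> 'a endo \<Rightarrow> 'a endo" is "\<lambda>f g x. f x - g x"
  by (simp add: algebra_simps)
lift_definition times_endo :: "'a endo \<Rightarrow> 'a endo \<Rightarrow> 'a endo" is "\<lambda>f g x. f (g x)"
  by simp

instance
proof
  show "(0 :: 'a endo) \<noteq> 1"
    by transfer (metis zero_neq_one)
qed (transfer; simp add: fun_eq_iff algebra_simps)+

end

definition schubert_derivation :: "(nat \<Rightarrow> 'n::finite trunc exterior endo) \<Rightarrow> bool" where
  "schubert_derivation D \<longleftrightarrow>
     (\<forall>h p q. app (D h) (p \<^bold>\<and> q) = (\<Sum>(h1, h2) \<in> {(h1, h2). h1 + h2 = h}. app (D h1) p \<^bold>\<and> app (D h2) q)) \<and>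
     (\<forall>l. \<forall>i\<ge>1. app (D l) (\<epsilon> i) = \<epsilon> (i + l))"

text \<open>\<open>D_t = \<Sum> D_i t^i\<close> and \<open>\<Sum> (-1)^i Dbar_i t^i\<close> are mutually inverse in
  \<open>End_\<int>(\<And> M_n)[[t]]\<close>.\<close>

definition inverse_coeffs ::
  "(nat \<Rightarrow> 'n::finite trunc exterior endo) \<Rightarrow> (nat \<Rightarrow> 'n trunc exterior endo) \<Rightarrow> bool" where
  "inverse_coeffs D Dbar \<longleftrightarrow>
     Abs_fps D * Abs_fps (\<lambda>i. (-1) ^ i * Dbar i) = 1 \<and>
     Abs_fps (\<lambda>i. (-1) ^ i * Dbar i) * Abs_fps D = 1"

text \<open>Such sequences \<open>D\<close> and \<open>Dbar\<close> exist: \<open>D_t\<close> is the ring homomorphism into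
  \<open>(\<And> M_n)[[t]]\<close> induced by \<open>x \<mapsto> \<Sum> (X^l x) t^l\<close>.\<close>

definition shift :: "nat \<Rightarrow> 'n::finite trunc \<Rightarrow> 'n trunc" where
  "shift l x = residue (monom 1 l * representative x)"

lemma shift_residue:
  assumes "monom 1 1 dvd p"
  shows "shift l (residue p :: 'n::finite trunc) = residue (monom 1 l * p)"
proof -
  let ?p = "representative (residue p :: 'n trunc)"
  have p: "monom 1 1 dvd ?p" by (rule representative(1))
  have "monom 1 (CARD('n) + 1) dvd ?p - p"
    using p assms representative(2)[of "residue p :: 'n trunc"]
    by (subst residue_eq_iff[where 'n = 'n, symmetric]) simp_all
  then have "monom 1 (CARD('n) + 1) dvd monom 1 l * (?p - p)" by (rule dvd_mult)
  then show ?thesis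
    unfolding shift_def using assms p
    by (subst residue_eq_iff) (simp_all add: right_diff_distrib dvd_mult del: One_nat_def)
qed

lemma shift_add: "shift l (x + y) = shift l x + shift l (y :: 'n::finite trunc)"
proof -
  note rep = representative(1)[of x] representative(1)[of y]
  have "x + y = residue (representative x + representative y)" by (rule plus_trunc_def)
  then have "shift l (x + y) = residue (monom 1 l * (representative x + representative y))"
    using rep by (simp add: shift_residue dvd_add del: One_nat_def)
  also have "\<dots> = shift l x + shift l y"
    unfolding shift_def using rep by (subst residue_add) (simp_all add: distrib_left dvd_mult del: One_nat_def)
  finally show ?thesis .
qed

lemma shift_0: "shift 0 x = x"
  by (simp add: shift_def representative(2) flip: one_poly_eq_simps(1) pCons_one)

lemma shift_eps:
  assumes "i \<ge> 1"
  shows "shift l (eps i) = (eps (i + l) :: 'n::finite trunc)"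
proof -
  have "monom (1 :: int) 1 dvd monom 1 i"
    using assms by (intro dvdI[of _ _ "monom 1 (i - 1)"]) (simp add: mult_monom)
  then show ?thesis
    by (simp add: eps_def shift_residue mult_monom add.commute del: One_nat_def)
qed

lemma iota_anticommute: "\<iota> x \<^bold>\<and> \<iota> y + \<iota> y \<^bold>\<and> \<iota> x = 0"
  using iota_square[of "x + y"] by (simp add: iota_add iota_square algebra_simps)

lemma sum_anticommute:
  fixes u :: "nat \<Rightarrow> 'b::ring_1"
  assumes "\<And>i. u i * u i = 0" "\<And>i j. u i * u j + u j * u i = 0"
  shows "(\<Sum>i = a..b. u i * u (a + b - i)) = 0"
proof (induction "Suc b - a" arbitrary: a b rule: less_induct)
  case less
  consider "b < a" | "a = b" | "a < b" by linarith
  then show ?case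
  proof cases
    case 3
    then obtain c where c: "b = Suc c" "a \<le> c" by (cases b) auto
    have "(\<Sum>i = a..b. u i * u (a + b - i)) =
        u a * u b + u b * u a + (\<Sum>i = Suc a..c. u i * u (a + b - i))"
      using c by (simp add: sum.atLeast_Suc_atMost)
    also have "(\<Sum>i = Suc a..c. u i * u (a + b - i)) = (\<Sum>i = Suc a..c. u i * u (Suc a + c - i))"
      using c by simp
    also have "\<dots> = 0" using c by (intro less) auto
    finally show ?thesis by (simp add: assms)
  qed (auto simp: assms)
qed

lemma schubert_derivation_exists:
  "\<exists>D Dbar :: nat \<Rightarrow> 'n::finite trunc exterior endo. schubert_derivation D \<and> inverse_coeffs D Dbar"
proof -
  define f :: "'n trunc \<Rightarrow> 'n trunc exterior fps" where "f = (\<lambda>x. Abs_fps (\<lambda>l. \<iota> (shift l x)))"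
  have "f (x + y) = f x + f y" for x y
    by (rule fps_ext) (simp add: f_def shift_add iota_add)
  moreover have "f x * f x = 0" for x
  proof (rule fps_ext)
    show "fps_nth (f x * f x) k = fps_nth 0 k" for k
      using sum_anticommute[of "\<lambda>l. \<iota> (shift l x)" 0 k]
      by (simp add: f_def fps_mult_nth iota_square iota_anticommute)
  qed
  ultimately obtain \<phi> where \<phi>: "\<And>x. \<phi> (\<iota> x) = f x" "\<phi> 1 = 1"
    "\<And>p q. \<phi> (p + q) = \<phi> p + \<phi> q" "\<And>p q. \<phi> (p \<^bold>\<and> q) = \<phi> p * \<phi> q"
    by (rule exterior_universal[of f]) blast
  define D where "D = (\<lambda>h. Endo (\<lambda>p. fps_nth (\<phi> p) h))"
  have app: "app (D h) p = fps_nth (\<phi> p) h" for h p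
    unfolding D_def by (subst Endo_inverse) (auto simp: \<phi>)
  have "(\<Sum>(h1, h2) \<in> {(h1, h2). h1 + h2 = h}. a h1 * b h2) = (\<Sum>i = 0..h. a i * b (h - i))"
    for a b :: "nat \<Rightarrow> 'n trunc exterior" and h
    by (rule sum.reindex_bij_witness[of _ "\<lambda>i. (i, h - i)" fst]) auto
  then have D: "schubert_derivation D"
    by (auto simp: schubert_derivation_def app \<phi> f_def fps_mult_nth shift_eps)
  have \<phi>_0: "\<phi> 0 = 0" using \<phi>(3)[of 0 0] by simp
  have "\<phi> p + \<phi> (- p) = 0" for p using \<phi>(3)[of p "- p"] \<phi>_0 by simp
  then have \<phi>_minus: "\<phi> (- p) = - \<phi> p" for p by (metis add.inverse_unique)
  have "app (D 0) p = p" for p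
    by (induction p rule: exterior_induct) (simp_all add: app \<phi> \<phi>_0 \<phi>_minus f_def shift_0)
  then have D0: "D 0 = 1"
    by (simp flip: app_inject add: one_endo.rep_eq fun_eq_iff)
  define F where "F = fps_right_inverse (Abs_fps D) 1"
  define Dbar where "Dbar = (\<lambda>i. (-1) ^ i * fps_nth F i)"
  have "(-1) ^ i * ((-1) ^ i * x) = x" for i and x :: "'n trunc exterior endo"
    by (simp add: minus_one_power_iff)
  then have F: "Abs_fps (\<lambda>i. (-1) ^ i * Dbar i) = F"
    by (intro fps_ext) (simp add: Dbar_def)
  have "Abs_fps D * F = 1"
    unfolding F_def by (rule fps_right_inverse) (simp add: D0)
  moreover have "fps_left_inverse (Abs_fps D) 1 = F"
    unfolding F_def by (rule fps_left_inverse_eq_fps_right_inverse) (simp_all add: D0)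
  then have "F * Abs_fps D = 1"
    using fps_left_inverse[of 1 "Abs_fps D"] by (simp add: D0)
  ultimately have "inverse_coeffs D Dbar" by (simp add: inverse_coeffs_def F)
  with D show ?thesis by blast
qed

end

theory Submission
  imports Defs
begin

text \<open>Let \<open>L x\<close> be left multiplication by \<open>x\<close>. The product rule for \<open>D\<close> says that
  \<open>D_t L x = (\<Sum> L (D_a x) t^a) D_t\<close> in \<open>End (\<And> M_n) [[t]]\<close>. For \<open>x = \<epsilon> i\<close> the series in brackets is the
  geometric series \<open>\<Sum> L (\<epsilon> (i + a)) t^a\<close>, so multiplying by the inverse of \<open>D_t\<close> on both sides gives
  \<open>D_t\<inverse> L (\<epsilon> i) = (L (\<epsilon> i) - t L (\<epsilon> (i + 1))) D_t\<inverse>\<close>, which is the case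
  \<open>m = 1\<close>. This case also shows, by induction on the number of factors, that the \<open>Dbar h\<close> commute;
  the general case then follows by a binomial induction.\<close>

text \<open>Splitting off the rightmost \<open>A\<close> gives
  \<open>A ^ Suc m * L k = A ^ m * L k * A + A ^ m * L (Suc k) * B\<close>. The induction hypothesis
  is thus used at both \<open>k\<close> and \<open>Suc k\<close>, and Pascal's rule combines the two
  sums.\<close>

lemma binomial_commutation:
  fixes A B :: "'a::ring_1" and L :: "nat \<Rightarrow> 'a"
  assumes AL: "\<And>k. A * L k = L k * A + L (Suc k) * B" and comm: "A * B = B * A"
  shows "A ^ m * L k = (\<Sum>j = 0..m. of_nat (m choose j) * (L (k + j) * (B ^ j * A ^ (m - j))))"
proof (induction m arbitrary: k)
  case (Suc m)
  define T where "T j = L (k + j) * (B ^ j * A ^ (Suc m - j))" for j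
  have pow: "A ^ l * B = B * A ^ l" for l
    by (induction l) (simp_all add: mult.assoc comm, simp add: mult.assoc[symmetric] comm)
  have 1: "L (k + j) * (B ^ j * A ^ (m - j)) * A = T j" if "j \<le> m" for j
    using that by (simp add: T_def mult.assoc Suc_diff_le power_Suc2 del: power_Suc)
  have 2: "L (Suc k + j) * (B ^ j * A ^ (m - j)) * B = T (Suc j)" for j
    by (simp add: T_def mult.assoc pow power_Suc2 del: power_Suc)
  have "A ^ Suc m * L k = A ^ m * L k * A + A ^ m * L (Suc k) * B"
    by (simp add: power_Suc2 mult.assoc AL distrib_left del: power_Suc)
  also have "A ^ m * L k * A = (\<Sum>j = 0..m. of_nat (m choose j) * T j)"
    unfolding Suc sum_distrib_right by (intro sum.cong) (simp_all add: 1[symmetric] mult.assoc)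
  \<comment> \<open>The top term may be added because \<open>m choose Suc m = 0\<close>; after the
    shift both sums run over \<open>T (Suc j)\<close>.\<close>
  also have "\<dots> = T 0 + (\<Sum>j = 0..m. of_nat (m choose Suc j) * T (Suc j))"
  proof -
    have "(\<Sum>j = 0..m. of_nat (m choose j) * T j) = (\<Sum>j = 0..Suc m. of_nat (m choose j) * T j)"
      by (simp add: binomial_eq_0)
    also have "\<dots> = T 0 + (\<Sum>j = 0..m. of_nat (m choose Suc j) * T (Suc j))"
      by (subst sum.atLeast0_atMost_Suc_shift) simp
    finally show ?thesis .
  qed
  also have "A ^ m * L (Suc k) * B = (\<Sum>j = 0..m. of_nat (m choose j) * T (Suc j))"
    unfolding Suc sum_distrib_right by (intro sum.cong) (simp_all add: 2[symmetric] mult.assoc)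
  also have "T 0 + (\<Sum>j = 0..m. of_nat (m choose Suc j) * T (Suc j)) +
      (\<Sum>j = 0..m. of_nat (m choose j) * T (Suc j)) =
      (\<Sum>j = 0..Suc m. of_nat (Suc m choose j) * T j)"
    by (subst sum.atLeast0_atMost_Suc_shift) (simp add: sum.distrib algebra_simps)
  finally show ?case by (simp add: T_def)
qed simp

lift_definition lmult :: "'a::ring_1 \<Rightarrow> 'a endo" is "\<lambda>x y. x * y"
  by (simp add: distrib_left)

lemma lmult_1: "lmult 1 = 1"
  by transfer simp

lemma app_sum: "app (sum f A) x = (\<Sum>a\<in>A. app (f a) x)"
  by (induction A rule: infinite_finite_induct) (simp_all add: zero_endo.rep_eq plus_endo.rep_eq)

lemma app_of_nat: "app (of_nat k) x = of_nat k * x"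
  by (induction k)
    (simp_all add: zero_endo.rep_eq plus_endo.rep_eq one_endo.rep_eq distrib_right)

lemma app_add: "app f (x + y) = app f x + app f y"
  using app by blast

lemma app_0: "app f 0 = 0"
  using app_add[of f 0 0] by simp

lemma app_uminus: "app f (- x) = - app f x"
  using app_add[of f x "- x"] app_0[of f] by (metis add.right_inverse add.inverse_unique)

lemma endo_eqI: "(\<And>x. app f x = app g x) \<Longrightarrow> f = g"
  by (simp add: app_inject[symmetric] fun_eq_iff)

lemma monom_dvd_monom_mult: "i \<ge> 1 \<Longrightarrow> monom (1::int) 1 dvd monom 1 i * g"
  by (intro dvd_mult2 dvdI[of _ _ "monom 1 (i - 1)"]) (simp add: mult_monom)

text \<open>The \<open>eps i\<close> with \<open>i \<ge> 1\<close> generate the additive group, so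
  closure under addition and negation suffices.\<close>

lemma trunc_induct:
  fixes x :: "'n::finite trunc"
  assumes P: "\<And>i. i \<ge> 1 \<Longrightarrow> P (eps i)" "P 0" "\<And>x. P x \<Longrightarrow> P (- x)"
    "\<And>x y. P x \<Longrightarrow> P y \<Longrightarrow> P (x + y)"
  shows "P x"
proof -
  have const: "P (residue (monom 1 i * [:a:]))" if i: "i \<ge> 1" for a :: int and i
  proof (induction a rule: int_of_nat_induct)
    have nat: "P (residue (monom 1 i * [:int k:]))" for k
    proof (induction k)
      case 0
      then show ?case using P(2) by (simp add: zero_trunc_def)
    next
      case (Suc k)
      have "monom 1 i * [:int (Suc k):] = monom 1 i * 1 + monom 1 i * [:int k:]"
        by (subst distrib_left[symmetric]) (simp add: one_pCons)
      then have "residue (monom 1 i * [:int (Suc k):]) =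
          (eps i + residue (monom 1 i * [:int k:]) :: 'n trunc)"
        using residue_add[OF monom_dvd_monom_mult[OF i, of 1] monom_dvd_monom_mult[OF i], where 'a = 'n]
        unfolding eps_def by (metis mult.right_neutral)
      then show ?case using Suc P(4)[OF P(1)[OF i]] by simp
    qed
    fix k
    show "P (residue (monom 1 i * [:int k:]))" by (rule nat)
    show "P (residue (monom 1 i * [:- int (Suc k):]))"
      using P(3)[OF nat[of "Suc k"]] residue_minus[OF monom_dvd_monom_mult[OF i], where 'a = 'n]
      by (metis minus_pCons minus_zero mult_minus_right)
  qed
  \<comment> \<open>With \<open>i\<close> arbitrary, the factor X in \<open>pCons a g\<close> can be
    absorbed into \<open>monom 1 (Suc i)\<close>.\<close>
  have "P (residue (monom 1 i * g))" if "i \<ge> 1" for i g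
    using that
  proof (induction g arbitrary: i rule: pCons_induct)
    case 0
    then show ?case using P(2) by (simp add: zero_trunc_def)
  next
    case (pCons a g)
    have "pCons a g = [:a:] + monom 1 1 * g" by (simp add: monom_Suc)
    then have "monom 1 i * pCons a g = monom 1 i * [:a:] + monom 1 (Suc i) * g"
      by (simp only: distrib_left mult.assoc[symmetric] mult_monom) simp
    then have "residue (monom 1 i * pCons a g) =
        (residue (monom 1 i * [:a:]) + residue (monom 1 (Suc i) * g) :: 'n trunc)"
      using pCons.prems by (simp only: residue_add monom_dvd_monom_mult)
    then show ?case using P(4)[OF const] pCons by simp
  qed
  moreover obtain g where "representative x = monom 1 1 * g"
    using representative(1)[of x] by (rule dvdE)
  ultimately show ?thesis using representative(2)[of x] by (metis order.refl)
qed

text \<open>Products are built one generator at a time from the left, the form in which the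
  commutation rule of \<open>Dbar h\<close> with \<open>lmult (\<epsilon> i)\<close>
  applies.\<close>

lemma exterior_eps_induct [case_names one zero uminus add eps]:
  fixes p :: "'n::finite trunc exterior"
  assumes "P 1" and zero: "P 0" and minus: "\<And>p. P p \<Longrightarrow> P (- p)"
    and add: "\<And>p q. P p \<Longrightarrow> P q \<Longrightarrow> P (p + q)"
    and eps: "\<And>i p. i \<ge> 1 \<Longrightarrow> P p \<Longrightarrow> P (\<epsilon> i \<^bold>\<and> p)"
  shows "P p"
proof -
  have iota_0: "\<iota> 0 = (0 :: 'n trunc exterior)" using iota_add[of 0 0] by simp
  have iota_minus: "\<iota> (- x) = - \<iota> x" for x :: "'n trunc"
    using iota_add[of x "- x"] iota_0 by (simp add: add.inverse_unique)
  have "P (\<iota> x \<^bold>\<and> q)" if "P q" for x q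
    by (induction x rule: trunc_induct)
      (simp_all add: eps that iota_0 iota_minus zero minus iota_add add distrib_right)
  \<comment> \<open>By associativity, the elements whose left multiplication preserves
    \<open>P\<close> are closed under products; \<open>q = 1\<close> then recovers
    \<open>P p\<close>.\<close>
  then have "\<forall>q. P q \<longrightarrow> P (p \<^bold>\<and> q)"
    by (induction p rule: exterior_induct) (simp_all add: zero minus add distrib_right mult.assoc)
  with \<open>P 1\<close> show ?thesis by fastforce
qed

text \<open>Comparing coefficients of t^h at \<open>p\<close> gives exactly the product rule for
  \<open>app (D h) (x * p)\<close>.\<close>

lemma schubert_derivation_lmult:
  assumes "schubert_derivation D"
  shows "Abs_fps D * fps_const (lmult x) = Abs_fps (\<lambda>a. lmult (app (D a) x)) * Abs_fps D"
proof (intro fps_ext endo_eqI)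
  fix h p
  have "(\<Sum>(h1, h2) \<in> {(h1, h2). h1 + h2 = h}. app (D h1) x \<^bold>\<and> app (D h2) p) =
      (\<Sum>a = 0..h. app (D a) x \<^bold>\<and> app (D (h - a)) p)"
    by (rule sum.reindex_bij_witness[of _ "\<lambda>a. (a, h - a)" fst]) auto
  then show "app (fps_nth (Abs_fps D * fps_const (lmult x)) h) p =
      app (fps_nth (Abs_fps (\<lambda>a. lmult (app (D a) x)) * Abs_fps D) h) p"
    using assms
    by (simp add: schubert_derivation_def fps_mult_nth[of "Abs_fps _" "Abs_fps _"] app_sum
        times_endo.rep_eq lmult.rep_eq)
qed

text \<open>For \<open>x = 1\<close> the product rule reads D_t = U D_t. Cancelling the invertible
  D_t leaves U = 1, and evaluating the coefficients of U at \<open>1\<close> gives the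
  values.\<close>

lemma schubert_derivation_one:
  assumes D: "schubert_derivation D" and inv: "inverse_coeffs D Dbar"
  shows "app (D h) 1 = (if h = 0 then 1 else 0)"
proof -
  let ?U = "Abs_fps (\<lambda>a. lmult (app (D a) 1))" and ?E = "Abs_fps (\<lambda>i. (-1) ^ i * Dbar i)"
  have "Abs_fps D = ?U * Abs_fps D"
    using schubert_derivation_lmult[OF D, of 1] by (simp add: lmult_1)
  from arg_cong[OF this, of "\<lambda>f. f * ?E"] have "Abs_fps D * ?E = ?U * (Abs_fps D * ?E)"
    by (simp only: mult.assoc)
  then have "?U = 1" using inv by (simp add: inverse_coeffs_def)
  from arg_cong[OF this, of "\<lambda>f. app (fps_nth f h) 1"]
  have "app (lmult (app (D h) 1)) 1 = app (if h = 0 then 1 else 0) 1" by simp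
  then show ?thesis
    by (simp add: lmult.rep_eq one_endo.rep_eq zero_endo.rep_eq split: if_splits)
qed

text \<open>This is the base case for proving commutativity. When the inverse relation is applied to
  \<open>1\<close>, only the summand \<open>a = h\<close> survives; the sign is harmless because the
  value is nonzero only at \<open>h = 0\<close>.\<close>

lemma inverse_coeffs_one:
  assumes D: "schubert_derivation D" and inv: "inverse_coeffs D Dbar"
  shows "app (Dbar h) 1 = (if h = 0 then 1 else 0)"
proof -
  have "fps_nth (Abs_fps (\<lambda>i. (-1) ^ i * Dbar i) * Abs_fps D) h = fps_nth 1 h"
    using inv by (simp add: inverse_coeffs_def)
  then have "(\<Sum>a = 0..h. (-1) ^ a * Dbar a * D (h - a)) = fps_nth 1 h"
    by (simp add: fps_mult_nth)
  from arg_cong[OF this, of "\<lambda>f. app f 1"]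
  have "(\<Sum>a = 0..h. app ((-1) ^ a * Dbar a) (app (D (h - a)) 1)) = app (fps_nth 1 h) 1"
    by (simp only: app_sum times_endo.rep_eq)
  moreover have "(\<Sum>a = 0..h. app ((-1) ^ a * Dbar a) (app (D (h - a)) 1)) =
      (\<Sum>a = 0..h. if a = h then app ((-1) ^ a * Dbar a) 1 else 0)"
    by (intro sum.cong) (auto simp: schubert_derivation_one[OF D inv] app_0)
  ultimately have "app ((-1) ^ h * Dbar h) 1 = app (fps_nth 1 h) 1"
    by simp
  then show ?thesis
    by (cases "even h")
      (auto simp: one_endo.rep_eq zero_endo.rep_eq uminus_endo.rep_eq split: if_splits)
qed

lemma inverse_coeffs_lmult_eps:
  assumes D: "schubert_derivation D" and inv: "inverse_coeffs D Dbar" and i: "i \<ge> 1"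
  shows "Dbar h * lmult (\<epsilon> i) =
    lmult (\<epsilon> i) * Dbar h + lmult (\<epsilon> (Suc i)) * (if h = 0 then 0 else Dbar (h - 1))"
proof -
  let ?D = "Abs_fps D" and ?E = "Abs_fps (\<lambda>i. (-1) ^ i * Dbar i)"
  let ?G = "\<lambda>i. Abs_fps (\<lambda>a. lmult (\<epsilon> (i + a)))"
  let ?L = "\<lambda>i. fps_const (lmult (\<epsilon> i))"
  have DL: "?D * ?L i = ?G i * ?D" if "i \<ge> 1" for i
    using schubert_derivation_lmult[OF D, of "\<epsilon> i"] D that by (simp add: schubert_derivation_def)
  \<comment> \<open>The geometric series telescopes to its constant term.\<close>
  have G: "?G i - fps_X * ?G (Suc i) = ?L i"
    by (rule fps_ext) simp
  have "?D * (?L i - fps_X * ?L (Suc i)) = ?D * ?L i - fps_X * (?D * ?L (Suc i))"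
    by (simp add: right_diff_distrib fps_mult_fps_X_commute mult.assoc)
  also have "\<dots> = (?G i - fps_X * ?G (Suc i)) * ?D"
    using i by (simp add: DL left_diff_distrib mult.assoc)
  finally have "?D * (?L i - fps_X * ?L (Suc i)) = ?L i * ?D"
    by (simp only: G)
  \<comment> \<open>The coefficient ring is noncommutative, so both one-sided inverse identities are
    used.\<close>
  then have "?E * ?D * (?L i - fps_X * ?L (Suc i)) * ?E = ?E * ?L i * (?D * ?E)"
    by (simp add: mult.assoc)
  then have "(?L i - fps_X * ?L (Suc i)) * ?E = ?E * ?L i"
    using inv by (simp add: inverse_coeffs_def)
  then have "fps_nth (?E * ?L i) h = fps_nth (?L i * ?E - fps_X * (?L (Suc i) * ?E)) h"
    by (simp add: left_diff_distrib mult.assoc)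
  then have "(-1) ^ h * Dbar h * lmult (\<epsilon> i) = lmult (\<epsilon> i) * ((-1) ^ h * Dbar h) -
      (if h = 0 then 0 else lmult (\<epsilon> (Suc i)) * ((-1) ^ (h - 1) * Dbar (h - 1)))"
    by simp
  \<comment> \<open>Passing from \<open>(-1) ^ h\<close> to \<open>(-1) ^ (h - 1)\<close> turns the
    minus into a plus.\<close>
  then show ?thesis
    by (cases h; cases "even h") (auto simp: algebra_simps add_eq_0_iff)
qed

lemma inverse_coeffs_commute:
  assumes D: "schubert_derivation D" and inv: "inverse_coeffs D Dbar"
  shows "Dbar h * Dbar k = Dbar k * Dbar h"
proof (rule endo_eqI)
  fix p
  define B where "B h = (if h = 0 then 0 else Dbar (h - 1))" for h
  have A: "app (Dbar h) (\<epsilon> i \<^bold>\<and> p) = \<epsilon> i \<^bold>\<and> app (Dbar h) p + \<epsilon> (Suc i) \<^bold>\<and> app (B h) p"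
    if "i \<ge> 1" for i h p
    using arg_cong[OF inverse_coeffs_lmult_eps[OF D inv that, of h], of "\<lambda>f. app f p"]
    by (simp add: times_endo.rep_eq plus_endo.rep_eq lmult.rep_eq B_def)
  \<comment> \<open>All \<open>h\<close> and \<open>k\<close> are treated at once, since
    \<open>B h\<close> and \<open>B k\<close> lower the indices.\<close>
  have "\<forall>h k. app (Dbar h) (app (Dbar k) p) = app (Dbar k) (app (Dbar h) p)"
  proof (induction p rule: exterior_eps_induct)
    case (eps i p)
    then have "app (B h) (app (Dbar k) p) = app (Dbar k) (app (B h) p)"
      "app (B h) (app (B k) p) = app (B k) (app (B h) p)" for h k
      by (simp_all add: B_def zero_endo.rep_eq app_0)
    then show ?case
      \<comment> \<open>Both orders expand into terms with \<open>\<epsilon> i\<close>,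
        \<open>\<epsilon> (Suc i)\<close> and \<open>\<epsilon> (Suc (Suc i))\<close>; the two mixed
        terms at \<open>\<epsilon> (Suc i)\<close> trade places when \<open>h\<close> and
        \<open>k\<close> are swapped.\<close>
      using eps by (simp add: A app_add algebra_simps)
  qed (simp_all add: app_0 app_uminus app_add inverse_coeffs_one[OF D inv])
  then show "app (Dbar h * Dbar k) p = app (Dbar k * Dbar h) p"
    by (simp add: times_endo.rep_eq)
qed

theorem theorem3p6:
  fixes D Dbar :: "nat \<Rightarrow> 'n::finite trunc exterior endo"
    and p :: "'n trunc exterior"
    and i h m :: nat
  assumes "schubert_derivation D"
    and "inverse_coeffs D Dbar"
    and "i \<ge> 1"
  shows "app (Dbar h ^ m) (\<epsilon> i \<^bold>\<and> p) =
    (\<Sum>j = 0..m. of_nat (m choose j) *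
       (\<epsilon> (i + j) \<^bold>\<and> app ((if h = 0 then 0 else Dbar (h - 1)) ^ j * Dbar h ^ (m - j)) p))"
proof -
  let ?B = "if h = 0 then 0 else Dbar (h - 1)"
  \<comment> \<open>Here \<open>L k\<close> is \<open>lmult (\<epsilon> (i + k))\<close>, taken at
    \<open>k = 0\<close>; the offset keeps every index at least 1.\<close>
  have "Dbar h ^ m * lmult (\<epsilon> (i + 0)) =
      (\<Sum>j = 0..m. of_nat (m choose j) * (lmult (\<epsilon> (i + (0 + j))) * (?B ^ j * Dbar h ^ (m - j))))"
  proof (rule binomial_commutation)
    show "Dbar h * lmult (\<epsilon> (i + k)) = lmult (\<epsilon> (i + k)) * Dbar h + lmult (\<epsilon> (i + Suc k)) * ?B" for k
      using inverse_coeffs_lmult_eps[OF assms(1,2), of "i + k"] assms(3) by simp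
    show "Dbar h * ?B = ?B * Dbar h"
      using inverse_coeffs_commute[OF assms(1,2)] by simp
  qed
  from arg_cong[OF this, of "\<lambda>f. app f p"] show ?thesis
    by (simp add: app_sum times_endo.rep_eq lmult.rep_eq app_of_nat del: if_split)
qed

end
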